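(* Let $n\ge3$ and $p\in\mathcal H(n,d)$. Then for every $j\in\{1,\dots,n\}$, at least $d$ of the monomials of $p$ with nonzero coefficient are divisible by $x_j$.
   Context: $s(x)=x_1+\dots+x_n$. $\mathcal H(n,d)$ is the set of $p\in\mathbb R[x_1,\dots,x_n]$ of degree $d$ with all coefficients nonnegative and $p(x)=1$ whenever $s(x)=1$. *)

theory Defs
  imports Complex_Main "HOL-Library.Poly_Mapping"
begin

text \<open>A real polynomial in variables x_0,...,x_{n-1} (the paper's x_1..x_n, shifted by one)
  is a finitely supported map from monomials (finitely supported exponent vectors
  nat =>0 nat) to real coefficients.\<close>

type_synonym mpoly_real = "(nat \<Rightarrow>\<^sub>0 nat) \<Rightarrow>\<^sub>0 real"

definition mon_deg :: "(nat \<Rightarrow>\<^sub>0 nat) \<Rightarrow> nat" where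
  "mon_deg \<alpha> = (\<Sum>i\<in>Poly_Mapping.keys \<alpha>. Poly_Mapping.lookup \<alpha> i)"

definition total_deg :: "mpoly_real \<Rightarrow> nat" where
  "total_deg p = Max (insert 0 (mon_deg ` Poly_Mapping.keys p))"

definition in_vars :: "nat \<Rightarrow> mpoly_real \<Rightarrow> bool" where
  "in_vars n p \<longleftrightarrow> (\<forall>\<alpha>\<in>Poly_Mapping.keys p. Poly_Mapping.keys \<alpha> \<subseteq> {..<n})"

definition eval_mon :: "(nat \<Rightarrow>\<^sub>0 nat) \<Rightarrow> (nat \<Rightarrow> real) \<Rightarrow> real" where
  "eval_mon \<alpha> x = (\<Prod>i\<in>Poly_Mapping.keys \<alpha>. x i ^ Poly_Mapping.lookup \<alpha> i)"

definition eval_poly :: "mpoly_real \<Rightarrow> (nat \<Rightarrow> real) \<Rightarrow> real" where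
  "eval_poly p x = (\<Sum>\<alpha>\<in>Poly_Mapping.keys p. Poly_Mapping.lookup p \<alpha> * eval_mon \<alpha> x)"

definition H :: "nat \<Rightarrow> nat \<Rightarrow> mpoly_real set" where
  "H n d = {p. in_vars n p \<and> total_deg p = d \<and> (\<forall>\<alpha>. Poly_Mapping.lookup p \<alpha> \<ge> 0) \<and>
              (\<forall>x::nat \<Rightarrow> real. (\<Sum>i<n. x i) = 1 \<longrightarrow> eval_poly p x = 1)}"

end

theory Submission
  imports Defs "HOL-Computational_Algebra.Polynomial"
begin

text \<open>
  Keep \<open>X = x\<^sub>j\<close> and one further variable \<open>T\<close>, set the remaining \<open>c = n - 2 > 0\<close> variables to 1,
  and let \<open>P\<^sub>m\<close> be the image of the part of \<open>p\<close> of degree \<open>m\<close> and \<open>s = X + (T + c)\<close>. Homogenising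
  \<open>p = 1\<close> gives \<open>\<Sum>\<^sub>m P\<^sub>m s\<^sup>d\<^sup>-\<^sup>m = s\<^sup>d\<close>, so the polynomials defined by \<open>q\<^sub>n = s q\<^sub>n\<^sub>-\<^sub>1 - P\<^sub>n\<close> from
  \<open>q\<^sub>0 = 1 - P\<^sub>0\<close> end with \<open>q\<^sub>d = 0\<close>.

  Give every coefficient of \<open>q\<^sub>n\<close>, a polynomial in \<open>T\<close>, the sign of its leading coefficient, and count
  the sign changes along the powers of \<open>X\<close>, the zero coefficients of \<open>q\<^sub>n\<close> being given convenient
  signs. Multiplication by \<open>s\<close> creates no sign change, and subtracting a monomial creates at most
  two. There are none for \<open>q\<^sub>0\<close>, and \<open>d\<close> for \<open>q\<^sub>d = 0\<close> with alternating signs. Monomials not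
  divisible by \<open>X\<close> are harmless because the constant coefficient in \<open>X\<close> is never negative.

  Do the same with the sign of the lowest nonzero coefficient in \<open>T\<close>. A monomial that creates two sign
  changes in one of the counts creates none in the other, since multiplication by \<open>T + c\<close> separates
  the top and the bottom power of \<open>T\<close>. Hence the two counts together yield
  \<open>2 d \<le> 2 M\<close>, where \<open>M\<close> is the number of monomials divisible by \<open>X\<close>.
\<close>

section \<open>Counting sign changes\<close>

definition sign_changes :: "(nat \<Rightarrow> bool) \<Rightarrow> nat \<Rightarrow> nat" where
  "sign_changes t n = (\<Sum>i<n. of_bool (t i \<noteq> t (Suc i)))"

text \<open>The disagreement term on the left makes the induction work: if \<open>t' (Suc k)\<close>
  is one of \<open>t k\<close> and \<open>t (Suc k)\<close>, then it lies on the way from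
  \<open>t k\<close> to \<open>t (Suc k)\<close>, and the triangle inequality for disagreement
  applies. An index in \<open>B\<close> costs at most 2.\<close>

lemma sign_changes_interlacing:
  assumes "t' 0 = t 0"
    and "\<And>i. i < k \<Longrightarrow> Suc i \<notin> B \<Longrightarrow> t' (Suc i) = t i \<or> t' (Suc i) = t (Suc i)"
  shows "sign_changes t' k + of_bool (t' k \<noteq> t k)
    \<le> sign_changes t k + (\<Sum>i=1..k. 2 * of_bool (i \<in> B))"
  using assms(2)
proof (induction k)
  case 0
  then show ?case by (simp add: sign_changes_def assms(1))
next
  case (Suc k)
  have IH: "sign_changes t' k + of_bool (t' k \<noteq> t k)
    \<le> sign_changes t k + (\<Sum>i=1..k. 2 * of_bool (i \<in> B))"
    using Suc by simp
  have s: "sign_changes f (Suc k) = sign_changes f k + of_bool (f k \<noteq> f (Suc k))" for f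
    by (simp add: sign_changes_def)
  have "Suc k \<in> B \<or> t' (Suc k) = t k \<or> t' (Suc k) = t (Suc k)"
    using Suc.prems[of k] by auto
  then show ?case using IH unfolding s
    by (cases "t k"; cases "t' k"; cases "t (Suc k)"; cases "t' (Suc k)"; auto)
qed

section \<open>Abstract sign functions and one step of the recursion\<close>

locale poly_sign =
  fixes \<sigma> :: "real poly \<Rightarrow> real" and c :: real
  assumes sign_eq_0_iff: "\<sigma> p = 0 \<longleftrightarrow> p = 0"
    and sign_minus: "\<sigma> (- p) = - \<sigma> p"
    and sign_add_pos: "\<sigma> p > 0 \<Longrightarrow> \<sigma> q \<ge> 0 \<Longrightarrow> \<sigma> (p + q) > 0"
    and sign_mult_pos: "\<sigma> p > 0 \<Longrightarrow> \<sigma> ([:c, 1:] * p) > 0"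
    and sign_nonneg: "(\<And>b. coeff p b \<ge> 0) \<Longrightarrow> \<sigma> p \<ge> 0"
begin

lemma sign_add_nonneg: "\<sigma> p \<ge> 0 \<Longrightarrow> \<sigma> q \<ge> 0 \<Longrightarrow> \<sigma> (p + q) \<ge> 0"
  using sign_add_pos[of p q] sign_eq_0_iff[of p] by (cases "\<sigma> p = 0") auto

lemma sign_add_neg: "\<sigma> p < 0 \<Longrightarrow> \<sigma> q \<le> 0 \<Longrightarrow> \<sigma> (p + q) < 0"
  using sign_add_pos[of "- p" "- q"] sign_minus[of p] sign_minus[of q] sign_minus[of "p + q"]
  by simp

lemma sign_mult_neg: "\<sigma> p < 0 \<Longrightarrow> \<sigma> ([:c, 1:] * p) < 0"
  using sign_mult_pos[of "- p"] sign_minus[of p] sign_minus[of "[:c, 1:] * p"] by simp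

lemma sign_mult_nonneg_iff: "\<sigma> ([:c, 1:] * p) \<ge> 0 \<longleftrightarrow> \<sigma> p \<ge> 0"
  using sign_mult_pos[of p] sign_mult_neg[of p] sign_eq_0_iff[of p] sign_eq_0_iff[of "[:c, 1:] * p"]
  by (cases "\<sigma> p" "0 :: real" rule: linorder_cases) auto

lemma sign_mult_nonpos: "\<sigma> p \<le> 0 \<Longrightarrow> \<sigma> ([:c, 1:] * p) \<le> 0"
  using sign_mult_neg[of p] sign_eq_0_iff[of p] sign_eq_0_iff[of "[:c, 1:] * p"]
  by (cases "\<sigma> p = 0") auto

text \<open>An upper bound for the number of sign changes created at index \<open>i \<ge> 1\<close> in passing from the
  coefficients \<open>u\<close> of \<open>q\<^sub>n\<close> to the coefficients \<open>u'\<close> of \<open>q\<^sub>n\<^sub>+\<^sub>1\<close>; the value 1 occurs only just above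
  the top nonzero coefficient of \<open>u\<close>.\<close>

definition cost :: "(nat \<Rightarrow> real poly) \<Rightarrow> (nat \<Rightarrow> real poly) \<Rightarrow> nat \<Rightarrow> nat" where
  "cost u u' i = (if \<sigma> (u i) > 0 \<and> \<sigma> (u (i - 1)) \<ge> 0 \<and> \<sigma> (u' i) \<le> 0 then 2
     else if (\<forall>k\<ge>i. u k = 0) \<and> \<sigma> (u (i - 1)) > 0 \<and> \<sigma> (u' i) \<le> 0 then 1 else 0)"

text \<open>Zero coefficients leave the sign free, except that \<open>t 0\<close> is always
  positive; therefore costs are summed only from index 1 on.\<close>

definition compatible :: "(nat \<Rightarrow> real poly) \<Rightarrow> nat \<Rightarrow> (nat \<Rightarrow> bool) \<Rightarrow> bool" where
  "compatible u n t \<longleftrightarrow> t 0 \<and> (\<forall>i\<le>n. (\<sigma> (u i) > 0 \<longrightarrow> t i) \<and> (\<sigma> (u i) < 0 \<longrightarrow> \<not> t i))"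

text \<open>Signs are transported backwards, from \<open>u'\<close> to \<open>u\<close>: the new
  coefficient at \<open>Suc i\<close> combines the old ones at \<open>i\<close> and
  \<open>Suc i\<close>, so its sign can be matched with one of theirs, except where subtracting
  \<open>P\<close> destroys a positive sign; \<open>cost\<close> pays for that.\<close>

lemma compatible_step:
  assumes rec: "\<And>i. u' (Suc i) = u i + [:c, 1:] * u (Suc i) - P (Suc i)"
    and P: "\<And>i b. coeff (P i) b \<ge> 0"
    and top: "\<And>i. i > n \<Longrightarrow> u i = 0"
    and nz: "\<exists>i. u i \<noteq> 0"
    and u0: "\<sigma> (u 0) \<ge> 0"
    and t': "compatible u' (Suc n) t'"
  obtains t where "compatible u n t"
    "sign_changes t' (Suc n) \<le> sign_changes t n + (\<Sum>i=1..Suc n. cost u u' i)"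
proof -
  \<comment> \<open>The index just above the last nonzero coefficient of \<open>u\<close>.\<close>
  define e where "e = Suc (Max {i. u i \<noteq> 0})"
  have fin: "finite {i. u i \<noteq> 0}"
    by (rule finite_subset[of _ "{..n}"]) (use top in \<open>force simp: not_less[symmetric]\<close>)+
  have e1: "u (e - 1) \<noteq> 0"
    using Max_in[OF fin] nz unfolding e_def by auto
  have e2: "u i = 0" if "i \<ge> e" for i
    using Max_ge[OF fin, of i] that unfolding e_def by fastforce
  have e_pos: "e \<ge> 1" unfolding e_def by simp
  have e_le: "e \<le> Suc n" using top[of "e - 1"] e1 by fastforce
  have t'0: "t' 0" using t' by (simp add: compatible_def)
  have t'_pos: "t' i" if "\<sigma> (u' i) > 0" "i \<le> Suc n" for i
    using t' that by (auto simp: compatible_def)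
  have t'_neg: "\<not> t' i" if "\<sigma> (u' i) < 0" "i \<le> Suc n" for i
    using t' that by (auto simp: compatible_def)
  have P': "\<sigma> (- P i) \<le> 0" for i
    using sign_nonneg[of "P i"] P by (simp add: sign_minus)
  have neg: "\<sigma> (u' (Suc i)) < 0" if "\<sigma> (u i) \<le> 0" "\<sigma> (u (Suc i)) \<le> 0"
      "\<sigma> (u i) < 0 \<or> \<sigma> (u (Suc i)) < 0" for i
  proof -
    have "\<sigma> (u i + [:c, 1:] * u (Suc i)) < 0"
      using that(3)
    proof
      assume "\<sigma> (u i) < 0"
      then show ?thesis using sign_mult_nonpos[OF that(2)] by (rule sign_add_neg)
    next
      assume "\<sigma> (u (Suc i)) < 0"
      then show ?thesis using sign_add_neg[OF sign_mult_neg that(1)] by (simp add: add.commute)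
    qed
    from sign_add_neg[OF this P'[of "Suc i"]] show ?thesis by (simp add: rec)
  qed
  \<comment> \<open>The free signs above the top coefficient are shifted by one index, which loses nothing, unless
    the new top coefficient lost its positive sign; then the last sign is dropped at the cost of one
    sign change.\<close>
  define paid where "paid \<longleftrightarrow> \<sigma> (u (e - 1)) > 0 \<and> \<sigma> (u' e) \<le> 0"
  define t where "t i = (if \<sigma> (u i) > 0 then True else if \<sigma> (u i) < 0 then False
      else if i < e \<or> paid then t' i else t' (Suc i))" for i
  define B where "B = {i. \<sigma> (u i) > 0 \<and> \<sigma> (u (i - 1)) \<ge> 0 \<and> \<sigma> (u' i) \<le> 0}"
  have t_zero: "t i = (if i < e \<or> paid then t' i else t' (Suc i))" if "u i = 0" for i
    using that sign_eq_0_iff[of 0] by (simp add: t_def)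
  \<comment> \<open>At \<open>e\<close> the new coefficient is \<open>u (e - 1) - P e\<close>, so a
    negative sign persists, and a positive one is lost only if \<open>paid\<close>.\<close>
  have t_e: "t' e = t (e - 1)" if "\<not> paid"
  proof (cases "\<sigma> (u (e - 1)) > 0")
    case True
    then have "t' e" using that t'_pos[of e] e_le by (auto simp: paid_def)
    then show ?thesis using True by (simp add: t_def)
  next
    case False
    then have l: "\<sigma> (u (e - 1)) < 0" using e1 sign_eq_0_iff[of "u (e - 1)"] by linarith
    then have "\<sigma> (u' e) < 0" using neg[of "e - 1"] e2[of e] e_pos sign_eq_0_iff[of "u e"] by simp
    then show ?thesis using t'_neg e_le l by (auto simp: t_def)
  qed
  have t0: "t 0"
    using u0 t'0 e_pos by (auto simp: t_def)
  \<comment> \<open>Zero coefficients have signs made to fit. At a nonzero one, a new sign differing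
    from both old signs means that these agree: two minus signs contradict \<open>neg\<close>, two
    plus signs put \<open>Suc i\<close> into \<open>B\<close>.\<close>
  have inter: "t' (Suc i) = t i \<or> t' (Suc i) = t (Suc i)" if i: "i < n" and B: "Suc i \<notin> B" for i
  proof (cases "u (Suc i) = 0")
    case True
    consider "Suc i < e \<or> paid" | "Suc i = e" "\<not> paid" | "i \<ge> e" "\<not> paid" by linarith
    then show ?thesis
      using t_zero[OF True] t_e t_zero[OF e2, of i] by cases auto
  next
    case False
    show ?thesis
    proof (rule ccontr)
      assume "\<not> ?thesis"
      then have n1: "t' (Suc i) \<noteq> t i" "t' (Suc i) \<noteq> t (Suc i)" by auto
      have "\<sigma> (u (Suc i)) \<noteq> 0" using False sign_eq_0_iff by blast
      then consider "\<sigma> (u (Suc i)) < 0" | "\<sigma> (u (Suc i)) > 0" by linarith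
      then show False
      proof cases
        case 1
        then have "\<not> t (Suc i)" by (simp add: t_def)
        then have "t' (Suc i)" "\<not> t i" using n1 by auto
        then have "\<sigma> (u i) \<le> 0" by (auto simp: t_def split: if_splits)
        then have "\<sigma> (u' (Suc i)) < 0" using neg[of i] 1 by simp
        then show False using t'_neg[of "Suc i"] i \<open>t' (Suc i)\<close> by simp
      next
        case 2
        then have "t (Suc i)" by (simp add: t_def)
        then have "\<not> t' (Suc i)" "t i" using n1 by auto
        then have "\<sigma> (u i) \<ge> 0" by (auto simp: t_def split: if_splits)
        moreover have "\<sigma> (u' (Suc i)) \<le> 0"
          using t'_pos[of "Suc i"] i \<open>\<not> t' (Suc i)\<close> by fastforce
        ultimately show False using B 2 by (simp add: B_def)
      qed
    qed
  qed
  have main: "sign_changes t' n + of_bool (t' n \<noteq> t n)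
      \<le> sign_changes t n + (\<Sum>i=1..n. 2 * of_bool (i \<in> B))"
    by (rule sign_changes_interlacing) (use t0 t'0 inter in auto)
  have s: "sign_changes t' (Suc n) = sign_changes t' n + of_bool (t' n \<noteq> t' (Suc n))"
    by (simp add: sign_changes_def)
  \<comment> \<open>\<open>t'\<close> has one sign more than \<open>t\<close>. If not
    \<open>paid\<close>, then \<open>t' (Suc n) = t n\<close> and the disagreement term of
    \<open>main\<close> covers the last change; if \<open>paid\<close>, the extra 1 does.\<close>
  have "sign_changes t' (Suc n)
      \<le> sign_changes t n + ((\<Sum>i=1..n. 2 * of_bool (i \<in> B)) + of_bool paid)"
  proof (cases paid)
    case True
    then show ?thesis using main unfolding s by (auto split: if_splits simp: of_bool_def)
  next
    case False
    have "t' (Suc n) = t n"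
    proof (cases "e = Suc n")
      case True
      then show ?thesis using t_e False by simp
    next
      case F: False
      then have "e \<le> n" using e_le by simp
      then show ?thesis using t_zero[OF e2, of n] False by simp
    qed
    then show ?thesis using main False unfolding s by (auto split: if_splits simp: of_bool_def)
  qed
  also have "(\<Sum>i=1..n. 2 * of_bool (i \<in> B)) \<le> (\<Sum>i=1..Suc n. 2 * of_bool (i \<in> B) :: nat)"
    by simp
  also have "(\<Sum>i=1..Suc n. 2 * of_bool (i \<in> B)) + of_bool paid
      = (\<Sum>i=1..Suc n. 2 * of_bool (i \<in> B) + (if i = e then of_bool paid else 0 :: nat))"
    using e_le e_pos by (simp add: sum.distrib)
  also have "\<dots> \<le> (\<Sum>i=1..Suc n. cost u u' i)"
  proof (rule sum_mono)
    fix i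
    \<comment> \<open>The charges 2 and 1 never meet at one index.\<close>
    have "e \<notin> B" using e2[of e] sign_eq_0_iff[of 0] by (simp add: B_def)
    then show "2 * of_bool (i \<in> B) + (if i = e then of_bool paid else 0) \<le> cost u u' i"
      using e2 by (auto simp: cost_def B_def paid_def)
  qed
  finally have "sign_changes t' (Suc n) \<le> sign_changes t n + (\<Sum>i=1..Suc n. cost u u' i)"
    by simp
  moreover have "compatible u n t" using t0 by (simp add: compatible_def t_def)
  ultimately show thesis using that by blast
qed

lemma degree_le_cost:
  fixes q P :: "nat \<Rightarrow> nat \<Rightarrow> real poly"
  assumes rec0: "\<And>n. q (Suc n) 0 = [:c, 1:] * q n 0 - P (Suc n) 0"
    and rec: "\<And>n i. q (Suc n) (Suc i) = q n i + [:c, 1:] * q n (Suc i) - P (Suc n) (Suc i)"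
    and P: "\<And>n i b. coeff (P n i) b \<ge> 0"
    and top: "\<And>n i. i > n \<Longrightarrow> q n i = 0"
    and nz: "\<And>n. n < d \<Longrightarrow> \<exists>i. q n i \<noteq> 0"
    and qd: "\<And>i. q d i = 0"
  shows "d \<le> (\<Sum>n<d. \<Sum>i=1..Suc n. cost (q n) (q (Suc n)) i)"
proof -
  \<comment> \<open>Read backwards, the recursion at index 0 adds two nonnegative signs, and
    removing the factor \<open>T + c\<close> keeps the sign.\<close>
  have q0: "\<sigma> (q n 0) \<ge> 0" if "n \<le> d" for n
    using that
  proof (induction n rule: inc_induct)
    case base
    then show ?case using qd sign_eq_0_iff by (metis order.refl)
  next
    case (step n)
    have "\<sigma> ([:c, 1:] * q n 0) = \<sigma> (q (Suc n) 0 + P (Suc n) 0)" by (simp add: rec0)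
    also have "\<dots> \<ge> 0" using step.IH sign_nonneg P by (intro sign_add_nonneg) auto
    finally show ?case by (simp only: sign_mult_nonneg_iff)
  qed
  have ex: "\<exists>t. compatible (q n) n t \<and>
     d \<le> sign_changes t n + (\<Sum>k=n..<d. \<Sum>i=1..Suc k. cost (q k) (q (Suc k)) i)" if "n \<le> d" for n
    using that
  proof (induction n rule: inc_induct)
    case base
    \<comment> \<open>All signs but the first are free, and \<open>even\<close> changes at every
      step.\<close>
    have "compatible (q d) d even" using qd sign_eq_0_iff[of 0] by (simp add: compatible_def)
    moreover have "sign_changes even d = d" by (simp add: sign_changes_def)
    ultimately show ?case by (intro exI[of _ even]) simp
  next
    case (step n)
    then obtain t' where t': "compatible (q (Suc n)) (Suc n) t'"
      "d \<le> sign_changes t' (Suc n) + (\<Sum>k=Suc n..<d. \<Sum>i=1..Suc k. cost (q k) (q (Suc k)) i)"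
      by blast
    obtain t where t: "compatible (q n) n t"
      "sign_changes t' (Suc n) \<le> sign_changes t n + (\<Sum>i=1..Suc n. cost (q n) (q (Suc n)) i)"
      by (rule compatible_step[OF rec P top nz q0 t'(1)]) (use step in auto)
    have "(\<Sum>k=n..<d. \<Sum>i=1..Suc k. cost (q k) (q (Suc k)) i)
      = (\<Sum>i=1..Suc n. cost (q n) (q (Suc n)) i)
        + (\<Sum>k=Suc n..<d. \<Sum>i=1..Suc k. cost (q k) (q (Suc k)) i)"
      using step.hyps by (intro sum.atLeast_Suc_lessThan) auto
    then show ?case using t t'(2) by (intro exI[of _ t]) linarith
  qed
  from ex[of 0] show ?thesis by (auto simp: sign_changes_def atLeast0LessThan)
qed

end

section \<open>Leading and trailing coefficients as sign functions\<close>

definition trailing_index :: "'a::zero poly \<Rightarrow> nat" where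
  "trailing_index p = (LEAST k. coeff p k \<noteq> 0)"

text \<open>For \<open>p = 0\<close> the index is unspecified, but the coefficient is 0 all the
  same.\<close>

definition trailing_coeff :: "'a::zero poly \<Rightarrow> 'a" where
  "trailing_coeff p = coeff p (trailing_index p)"

lemma coeff_eq_0_below_trailing_index: "k < trailing_index p \<Longrightarrow> coeff p k = 0"
  unfolding trailing_index_def using not_less_Least by blast

lemma trailing_coeff_eq_0_iff: "trailing_coeff p = 0 \<longleftrightarrow> p = 0"
proof
  show "p = 0" if "trailing_coeff p = 0"
  proof (rule ccontr)
    assume "p \<noteq> 0"
    then have "coeff p (degree p) \<noteq> 0" by simp
    then have "coeff p (LEAST k. coeff p k \<noteq> 0) \<noteq> 0" by (rule LeastI)
    then show False using that by (simp add: trailing_coeff_def trailing_index_def)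
  qed
qed (simp add: trailing_coeff_def)

lemma trailing_index_eqI:
  "coeff p k \<noteq> 0 \<Longrightarrow> (\<And>i. i < k \<Longrightarrow> coeff p i = 0) \<Longrightarrow> trailing_index p = k"
  unfolding trailing_index_def by (intro Least_equality) (auto simp: not_less[symmetric])

lemma trailing_index_le_degree: "p \<noteq> 0 \<Longrightarrow> trailing_index p \<le> degree p"
  unfolding trailing_index_def by (intro Least_le) simp

lemma trailing_index_mult_linear:
  fixes p :: "real poly"
  assumes "c \<noteq> 0" "p \<noteq> 0"
  shows "trailing_index ([:c, 1:] * p) = trailing_index p"
    and "trailing_coeff ([:c, 1:] * p) = c * trailing_coeff p"
proof -
  have c: "coeff ([:c, 1:] * p) i = c * coeff p i + (if i = 0 then 0 else coeff p (i - 1))" for i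
    by (simp add: coeff_pCons split: nat.split)
  have z: "coeff p (trailing_index p - 1) = 0" if "trailing_index p \<noteq> 0"
    using that by (intro coeff_eq_0_below_trailing_index) auto
  have nz: "coeff p (trailing_index p) \<noteq> 0"
    using assms(2) trailing_coeff_eq_0_iff[of p] by (simp add: trailing_coeff_def)
  show i: "trailing_index ([:c, 1:] * p) = trailing_index p"
    by (rule trailing_index_eqI) (use nz z assms in \<open>auto simp: c coeff_eq_0_below_trailing_index simp del: mult_pCons_left\<close>)
  show "trailing_coeff ([:c, 1:] * p) = c * trailing_coeff p"
    unfolding trailing_coeff_def i c using z by auto
qed

lemma trailing_add_pos:
  fixes p q :: "real poly"
  assumes "trailing_coeff p > 0" "trailing_coeff q \<ge> 0"
  shows "trailing_index (p + q) \<le> trailing_index p" and "trailing_coeff (p + q) > 0"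
proof -
  have "trailing_index (p + q) \<le> trailing_index p \<and> trailing_coeff (p + q) > 0"
  proof (cases "q = 0")
    case False
    then have q: "coeff q (trailing_index q) > 0"
      using assms(2) trailing_coeff_eq_0_iff[of q] by (simp add: trailing_coeff_def)
    have p: "coeff p (trailing_index p) > 0" using assms by (simp add: trailing_coeff_def)
    define k where "k = min (trailing_index p) (trailing_index q)"
    have pos: "coeff (p + q) k > 0"
      unfolding k_def
      by (cases "trailing_index p" "trailing_index q" rule: linorder_cases)
        (use p q in \<open>auto simp: coeff_eq_0_below_trailing_index add_pos_pos\<close>)
    have "trailing_index (p + q) = k"
      by (rule trailing_index_eqI) (use pos in \<open>auto simp: k_def coeff_eq_0_below_trailing_index\<close>)
    then show ?thesis using pos by (simp add: trailing_coeff_def k_def)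
  qed (use assms in auto)
  then show "trailing_index (p + q) \<le> trailing_index p" "trailing_coeff (p + q) > 0" by auto
qed

lemma lead_add_pos:
  fixes p q :: "real poly"
  assumes "lead_coeff p > 0" "lead_coeff q \<ge> 0"
  shows "degree (p + q) \<ge> degree p" and "lead_coeff (p + q) > 0"
proof -
  have "degree (p + q) \<ge> degree p \<and> lead_coeff (p + q) > 0"
  proof (cases "q = 0")
    case False
    then have q: "lead_coeff q > 0" using assms(2) by (metis leading_coeff_0_iff less_eq_real_def)
    show ?thesis
    proof (cases "degree p" "degree q" rule: linorder_cases)
      case equal
      then have pos: "coeff (p + q) (degree p) > 0" using assms q by simp
      then have "degree (p + q) = degree p"
        using equal by (metis antisym degree_add_le le_degree less_irrefl order_refl)
      then show ?thesis using pos by simp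
    qed (use assms q in \<open>auto simp: degree_add_eq_left degree_add_eq_right coeff_eq_0\<close>)
  qed (use assms in auto)
  then show "degree (p + q) \<ge> degree p" "lead_coeff (p + q) > 0" by auto
qed

lemma lead_mult_linear:
  fixes p :: "real poly"
  assumes "p \<noteq> 0"
  shows "degree ([:c, 1:] * p) = Suc (degree p)" and "lead_coeff ([:c, 1:] * p) = lead_coeff p"
proof -
  show "degree ([:c, 1:] * p) = Suc (degree p)"
    using assms by (subst degree_mult_eq) auto
  show "lead_coeff ([:c, 1:] * p) = lead_coeff p"
    by (simp only: lead_coeff_mult) simp
qed

lemma poly_sign_lead: "poly_sign lead_coeff c"
proof
  show "lead_coeff ([:c, 1:] * p) > 0" if "lead_coeff p > 0" for p :: "real poly"
    using that lead_mult_linear(2)[of p c] by force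
qed (use lead_add_pos in auto)

lemma poly_sign_trailing:
  assumes "c > 0"
  shows "poly_sign trailing_coeff c"
proof
  show "trailing_coeff ([:c, 1:] * p) > 0" if "trailing_coeff p > 0" for p :: "real poly"
  proof -
    have "p \<noteq> 0" using that trailing_coeff_eq_0_iff[of p] by force
    then have "trailing_coeff ([:c, 1:] * p) = c * trailing_coeff p"
      using assms by (intro trailing_index_mult_linear) auto
    then show ?thesis using that assms by simp
  qed
  show "trailing_coeff (- p) = - trailing_coeff p" for p :: "real poly"
    by (simp add: trailing_coeff_def trailing_index_def)
  show "trailing_coeff p \<ge> 0" if "\<And>b. coeff p b \<ge> 0" for p :: "real poly"
    using that by (simp add: trailing_coeff_def)
qed (use trailing_add_pos in \<open>auto simp: trailing_coeff_eq_0_iff\<close>)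

section \<open>Charging both counts to monomials\<close>

lemma lead_coeff_diff_nonpos:
  fixes p r :: "real poly"
  assumes "lead_coeff p > 0" "lead_coeff (p - r) \<le> 0"
  shows "\<exists>b\<ge>degree p. coeff r b \<noteq> 0"
proof (rule ccontr)
  assume "\<not> ?thesis"
  then have z: "coeff r b = 0" if "b \<ge> degree p" for b using that by auto
  have "degree (p - r) = degree p"
  proof (rule antisym)
    show "degree (p - r) \<le> degree p" by (rule degree_le) (use z in \<open>auto simp: coeff_eq_0\<close>)
    show "degree p \<le> degree (p - r)" by (rule le_degree) (use z assms in auto)
  qed
  then show False using assms z[of "degree p"] by simp
qed

lemma trailing_coeff_diff_nonpos:
  fixes p r :: "real poly"
  assumes "trailing_coeff p > 0" "trailing_coeff (p - r) \<le> 0"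
  shows "\<exists>b\<le>trailing_index p. coeff r b \<noteq> 0"
proof (rule ccontr)
  assume "\<not> ?thesis"
  then have z: "coeff r b = 0" if "b \<le> trailing_index p" for b using that by auto
  have "trailing_index (p - r) = trailing_index p"
    by (rule trailing_index_eqI)
      (use z assms in \<open>auto simp: trailing_coeff_def coeff_eq_0_below_trailing_index\<close>)
  then show False using assms z[of "trailing_index p"] by (simp add: trailing_coeff_def)
qed

abbreviation support :: "real poly \<Rightarrow> nat set" where
  "support p \<equiv> {b. coeff p b \<noteq> 0}"

lemma finite_support: "finite (support p)"
  by (rule finite_subset[of _ "{..degree p}"]) (auto simp: le_degree)

text \<open>If both counts charge 2, then \<open>r\<close> has one monomial above
  \<open>degree (u i)\<close> and another at or below it.\<close>

lemma cost_le_support: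
  assumes c: "c > 0"
    and rec: "u' i = u (i - 1) + [:c, 1:] * u i - r"
  shows "poly_sign.cost lead_coeff u u' i + poly_sign.cost trailing_coeff u u' i
    \<le> 2 * card (support r)"
proof -
  interpret L: poly_sign lead_coeff c by (rule poly_sign_lead)
  interpret M: poly_sign trailing_coeff c by (rule poly_sign_trailing[OF c])
  define v where "v = u (i - 1) + [:c, 1:] * u i"
  define A where "A \<longleftrightarrow> lead_coeff (u i) > 0 \<and> lead_coeff (u (i - 1)) \<ge> 0 \<and> lead_coeff (u' i) \<le> 0"
  define B where "B \<longleftrightarrow> trailing_coeff (u i) > 0 \<and> trailing_coeff (u (i - 1)) \<ge> 0 \<and> trailing_coeff (u' i) \<le> 0"
  have u': "u' i = v - r" by (simp add: rec v_def)
  have A: "\<exists>b\<ge>Suc (degree (u i)). coeff r b \<noteq> 0" if A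
  proof -
    have l: "lead_coeff ([:c, 1:] * u i) > 0" using that L.sign_mult_pos by (auto simp: A_def)
    have nz: "u i \<noteq> 0" using that by (auto simp: A_def)
    \<comment> \<open>The factor \<open>T + c\<close> raises the degree by one, and adding
      \<open>u (i - 1)\<close> cannot lower it.\<close>
    have "Suc (degree (u i)) \<le> degree v" "lead_coeff v > 0"
      using lead_add_pos[OF l, of "u (i - 1)"] that lead_mult_linear(1)[OF nz, of c]
      by (auto simp: A_def v_def add.commute simp del: mult_pCons_left)
    moreover have "lead_coeff (v - r) \<le> 0" using that by (simp add: A_def u')
    ultimately show ?thesis using lead_coeff_diff_nonpos[of v r] order_trans by blast
  qed
  have B: "\<exists>b\<le>degree (u i). coeff r b \<noteq> 0" if B
  proof -
    have l: "trailing_coeff ([:c, 1:] * u i) > 0" using that M.sign_mult_pos by (auto simp: B_def)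
    have nz: "u i \<noteq> 0" using that trailing_coeff_eq_0_iff[of "u i"] by (auto simp: B_def)
    \<comment> \<open>As \<open>c\<close> is nonzero, the factor \<open>T + c\<close> keeps the
      lowest power in place.\<close>
    have "trailing_index v \<le> degree (u i)" "trailing_coeff v > 0"
      using trailing_add_pos[OF l, of "u (i - 1)"] that trailing_index_mult_linear(1)[OF _ nz, of c] c
        trailing_index_le_degree[OF nz]
      by (auto simp: B_def v_def add.commute simp del: mult_pCons_left)
    moreover have "trailing_coeff (v - r) \<le> 0" using that by (simp add: B_def u')
    ultimately show ?thesis using trailing_coeff_diff_nonpos[of v r] order_trans by blast
  qed
  have card1: "card (support r) \<ge> 1" if "coeff r b \<noteq> 0" for b
    using that finite_support[of r] by (metis (mono_tags, lifting) One_nat_def Suc_leI card_gt_0_iff empty_iff mem_Collect_eq)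
  have card2: "card (support r) \<ge> 2" if "A" "B"
  proof -
    obtain b1 b2 where "b1 \<ge> Suc (degree (u i))" "b2 \<le> degree (u i)" "{b1, b2} \<subseteq> support r"
      using A[OF \<open>A\<close>] B[OF \<open>B\<close>] by auto
    then show ?thesis using card_mono[OF finite_support, of "{b1, b2}" r] by auto
  qed
  show ?thesis
  proof (cases "u i = 0")
    case True
    \<comment> \<open>Each count charges at most 1 here, so a single monomial of \<open>r\<close>
      pays for both.\<close>
    have T0: "trailing_coeff (0 :: real poly) = 0" by (simp add: trailing_coeff_eq_0_iff)
    have v: "v = u (i - 1)" by (simp add: v_def True)
    have "\<exists>b. coeff r b \<noteq> 0" if "L.cost u u' i \<noteq> 0 \<or> M.cost u u' i \<noteq> 0"
      using that lead_coeff_diff_nonpos[of v r] trailing_coeff_diff_nonpos[of v r]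
      by (auto simp: L.cost_def M.cost_def True T0 u' v split: if_splits)
    moreover have "L.cost u u' i \<le> 1" "M.cost u u' i \<le> 1"
      by (auto simp: L.cost_def M.cost_def True T0)
    ultimately show ?thesis using card1 by fastforce
  next
    case False
    then have "L.cost u u' i = 2 * of_bool A" "M.cost u u' i = 2 * of_bool B"
      by (auto simp: L.cost_def M.cost_def A_def B_def)
    then show ?thesis using card1 card2 A B by (cases A; cases B) fastforce+
  qed
qed

section \<open>The bound in two variables\<close>

theorem degree_le_sum_card_support:
  fixes P :: "nat \<Rightarrow> real poly poly" and c :: real
  defines "s \<equiv> [:[:c, 1:], 1:]"
  assumes c: "c > 0"
    and eq: "(\<Sum>m\<le>d. P m * s ^ (d - m)) = s ^ d"
    and nonneg: "\<And>m i b. coeff (coeff (P m) i) b \<ge> 0"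
    and deg: "\<And>m i. i > m \<Longrightarrow> coeff (P m) i = 0"
    and nz: "P d \<noteq> 0"
  shows "d \<le> (\<Sum>n<d. \<Sum>i=1..Suc n. card (support (coeff (P (Suc n)) i)))"
proof -
  interpret L: poly_sign lead_coeff c by (rule poly_sign_lead)
  interpret M: poly_sign trailing_coeff c by (rule poly_sign_trailing[OF c])
  \<comment> \<open>The defect of the homogenised identity truncated at degree \<open>n\<close>; it
    vanishes for \<open>n = d\<close> by \<open>eq\<close>.\<close>
  define q where "q n = s ^ n - (\<Sum>m\<le>n. P m * s ^ (n - m))" for n
  have q_Suc: "q (Suc n) = s * q n - P (Suc n)" for n
  proof -
    have "(\<Sum>m\<le>n. P m * s ^ (Suc n - m)) = s * (\<Sum>m\<le>n. P m * s ^ (n - m))"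
      unfolding sum_distrib_left by (intro sum.cong) (auto simp: Suc_diff_le)
    then show ?thesis by (simp add: q_def algebra_simps)
  qed
  have qd: "q d = 0" by (simp add: q_def eq)
  have rec0: "coeff (q (Suc n)) 0 = [:c, 1:] * coeff (q n) 0 - coeff (P (Suc n)) 0" for n
    by (simp add: q_Suc s_def)
  have rec: "coeff (q (Suc n)) (Suc i)
     = coeff (q n) i + [:c, 1:] * coeff (q n) (Suc i) - coeff (P (Suc n)) (Suc i)" for n i
    by (simp add: q_Suc s_def)
  have top: "coeff (q n) i = 0" if "i > n" for n i
    using that
  proof (induction n arbitrary: i)
    case 0
    then show ?case using deg[of 0 i] by (simp add: q_def)
  next
    case (Suc n)
    then obtain k where "i = Suc k" "k > n" by (cases i) auto
    then show ?case using Suc deg[of "Suc n" i] by (simp add: rec)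
  qed
  \<comment> \<open>Evaluation at \<open>X = T = 1\<close>, where \<open>s\<close> is
    \<open>c + 2\<close>, serves to show \<open>q n \<noteq> 0\<close> for
    \<open>n < d\<close>.\<close>
  define ev where "ev r = poly (poly r 1) 1" for r :: "real poly poly"
  have ev_sum: "ev r = (\<Sum>i\<le>degree r. \<Sum>b\<le>degree (coeff r i). coeff (coeff r i) b)" for r
    by (simp add: ev_def poly_altdef[of r] poly_sum poly_altdef[of "coeff r _"])
  have ev_P: "ev (P m) \<ge> 0" for m
    unfolding ev_sum using nonneg by (intro sum_nonneg) auto
  have ev_Pd: "ev (P d) > 0"
  proof -
    have "0 < coeff (coeff (P d) (degree (P d))) (degree (lead_coeff (P d)))"
      using nz nonneg[of d "degree (P d)" "degree (lead_coeff (P d))"]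
      by (simp add: less_eq_real_def)
    also have "\<dots> \<le> (\<Sum>b\<le>degree (lead_coeff (P d)). coeff (lead_coeff (P d)) b)"
      using nonneg by (intro member_le_sum) auto
    also have "\<dots> \<le> ev (P d)"
      unfolding ev_sum
      using nonneg by (intro member_le_sum[of "degree (P d)" _ "\<lambda>i. \<Sum>b\<le>degree (coeff (P d) i). coeff (coeff (P d) i) b"] sum_nonneg) auto
    finally show ?thesis .
  qed
  have ev_q: "ev (q (Suc n)) = (c + 2) * ev (q n) - ev (P (Suc n))" for n
    by (simp add: q_Suc ev_def s_def algebra_simps)
  \<comment> \<open>Going down from \<open>q d = 0\<close>, the positive \<open>ev (P d)\<close>
    enters in the first step, and positivity is never lost afterwards.\<close>
  have ev_nonneg: "ev (q n) \<ge> 0 \<and> (n < d \<longrightarrow> ev (q n) > 0)" if "n \<le> d" for n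
    using that
  proof (induction n rule: inc_induct)
    case base
    then show ?case by (simp add: qd ev_def)
  next
    case (step n)
    have "ev (q (Suc n)) > 0 \<or> ev (P (Suc n)) > 0"
      using step ev_Pd by (cases "Suc n = d") auto
    then have "(c + 2) * ev (q n) > 0"
      using step.IH ev_P[of "Suc n"] ev_q[of n] by linarith
    then show ?case using c by (simp add: zero_less_mult_iff)
  qed
  have nzq: "\<exists>i. coeff (q n) i \<noteq> 0" if "n < d" for n
  proof -
    have "q n \<noteq> 0" using ev_nonneg[of n] that by (auto simp: ev_def)
    then show ?thesis by (auto simp: poly_eq_iff)
  qed
  have "d + d \<le> (\<Sum>n<d. \<Sum>i=1..Suc n. L.cost (coeff (q n)) (coeff (q (Suc n))) i)
      + (\<Sum>n<d. \<Sum>i=1..Suc n. M.cost (coeff (q n)) (coeff (q (Suc n))) i)"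
    using rec0 rec nonneg top nzq
    by (intro add_mono L.degree_le_cost[where P = "\<lambda>n. coeff (P n)"]
        M.degree_le_cost[where P = "\<lambda>n. coeff (P n)"]) (auto simp: qd)
  also have "\<dots> = (\<Sum>n<d. \<Sum>i=1..Suc n. L.cost (coeff (q n)) (coeff (q (Suc n))) i
      + M.cost (coeff (q n)) (coeff (q (Suc n))) i)"
    by (simp only: sum.distrib)
  also have "\<dots> \<le> (\<Sum>n<d. \<Sum>i=1..Suc n. 2 * card (support (coeff (P (Suc n)) i)))"
  proof (intro sum_mono)
    fix n i assume "i \<in> {1..Suc n}"
    then have "i = Suc (i - 1)" by auto
    then show "L.cost (coeff (q n)) (coeff (q (Suc n))) i + M.cost (coeff (q n)) (coeff (q (Suc n))) i
        \<le> 2 * card (support (coeff (P (Suc n)) i))"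
      using rec[of n "i - 1"] by (intro cost_le_support[OF c]) auto
  qed
  also have "\<dots> = 2 * (\<Sum>n<d. \<Sum>i=1..Suc n. card (support (coeff (P (Suc n)) i)))"
    by (simp only: sum_distrib_left)
  finally show ?thesis by linarith
qed

section \<open>Reduction to two variables\<close>

text \<open>Finiteness of roots is used twice: in \<open>T\<close> for fixed \<open>X\<close>, then
  over the domain of polynomials in \<open>T\<close>, where the constants \<open>[:X:]\<close> are
  infinitely many roots.\<close>

lemma bivariate_poly_eq_0I:
  fixes r :: "real poly poly"
  assumes "\<And>X T. X > 0 \<Longrightarrow> T > 0 \<Longrightarrow> poly (poly r [:X:]) T = 0"
  shows "r = 0"
proof (rule ccontr)
  assume "r \<noteq> 0"
  have z: "poly r [:X:] = 0" if "X > 0" for X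
  proof (rule ccontr)
    assume "poly r [:X:] \<noteq> 0"
    then have "finite {T. poly (poly r [:X:]) T = 0}" by (rule poly_roots_finite)
    moreover have "{0<..} \<subseteq> {T. poly (poly r [:X:]) T = 0}" using assms[OF that] by auto
    ultimately show False using finite_subset infinite_Ioi by blast
  qed
  have "finite {x. poly r x = 0}" using \<open>r \<noteq> 0\<close> by (rule poly_roots_finite)
  moreover have "(\<lambda>X. [:X:]) ` {0<..} \<subseteq> {x. poly r x = 0}" using z by auto
  ultimately have "finite ((\<lambda>X. [:X:]) ` {0 :: real<..})" by (rule rev_finite_subset)
  then have "finite {0 :: real<..}" by (rule finite_imageD) (simp add: inj_on_def)
  then show False using infinite_Ioi by blast
qed

text \<open>The part of degree \<open>m\<close>, with \<open>x\<^sub>j\<close> as the outer variable,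
  \<open>x\<^sub>l\<close> as the inner one, and all other variables set to 1.\<close>

definition slice :: "mpoly_real \<Rightarrow> nat \<Rightarrow> nat \<Rightarrow> nat \<Rightarrow> real poly poly" where
  "slice p j l m = (\<Sum>\<alpha> | \<alpha> \<in> Poly_Mapping.keys p \<and> mon_deg \<alpha> = m.
     monom (monom (Poly_Mapping.lookup p \<alpha>) (Poly_Mapping.lookup \<alpha> l)) (Poly_Mapping.lookup \<alpha> j))"

lemma coeff_slice:
  "coeff (coeff (slice p j l m) i) b = (\<Sum>\<alpha> | \<alpha> \<in> Poly_Mapping.keys p \<and> mon_deg \<alpha> = m.
     if Poly_Mapping.lookup \<alpha> j = i \<and> Poly_Mapping.lookup \<alpha> l = b then Poly_Mapping.lookup p \<alpha> else 0)"
proof -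
  have "coeff (coeff (monom (monom a x) y) i) b = (if y = i \<and> x = b then a else 0)"
    for a :: real and x y by (simp add: coeff_monom)
  then show ?thesis by (simp only: slice_def coeff_sum)
qed

lemma coeff_slice_neq_0D:
  assumes "coeff (coeff (slice p j l m) i) b \<noteq> 0"
  obtains \<alpha> where "\<alpha> \<in> Poly_Mapping.keys p" "mon_deg \<alpha> = m"
    "Poly_Mapping.lookup \<alpha> j = i" "Poly_Mapping.lookup \<alpha> l = b"
proof -
  obtain \<alpha> where "\<alpha> \<in> Poly_Mapping.keys p" "mon_deg \<alpha> = m"
     "(if Poly_Mapping.lookup \<alpha> j = i \<and> Poly_Mapping.lookup \<alpha> l = b then Poly_Mapping.lookup p \<alpha> else 0) \<noteq> 0"
    using sum.not_neutral_contains_not_neutral[OF assms[unfolded coeff_slice]] by blast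
  then show thesis using that by (simp split: if_splits)
qed

lemma lookup_le_mon_deg: "Poly_Mapping.lookup \<alpha> j \<le> mon_deg \<alpha>"
proof (cases "j \<in> Poly_Mapping.keys \<alpha>")
  case True
  then show ?thesis unfolding mon_deg_def by (intro member_le_sum) auto
qed (simp add: in_keys_iff)

lemma mon_deg_le_total_deg: "\<alpha> \<in> Poly_Mapping.keys p \<Longrightarrow> mon_deg \<alpha> \<le> total_deg p"
  unfolding total_deg_def by (intro Max_ge) auto

lemma total_deg_attained:
  assumes "total_deg p > 0"
  obtains \<alpha> where "\<alpha> \<in> Poly_Mapping.keys p" "mon_deg \<alpha> = total_deg p"
proof -
  have "total_deg p \<in> insert 0 (mon_deg ` Poly_Mapping.keys p)"
    unfolding total_deg_def by (intro Max_in) auto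
  then show thesis using assms that by auto
qed

lemma eval_mon_two_variables:
  fixes X T S :: real
  assumes "j \<noteq> l"
  shows "eval_mon \<alpha> (\<lambda>k. (if k = j then X else if k = l then T else 1) / S)
    = X ^ Poly_Mapping.lookup \<alpha> j * T ^ Poly_Mapping.lookup \<alpha> l / S ^ mon_deg \<alpha>"
proof -
  let ?K = "Poly_Mapping.keys \<alpha>"
  have split: "((if k = j then X else if k = l then T else 1) / S) ^ e
    = (if k = j then X ^ e else 1) * (if k = l then T ^ e else 1) / S ^ e" for k e
    using assms by (auto simp: power_divide)
  have single: "(\<Prod>k\<in>?K. if k = a then Y ^ Poly_Mapping.lookup \<alpha> k else 1)
      = Y ^ Poly_Mapping.lookup \<alpha> a" for a and Y :: real
    by (simp add: prod.delta in_keys_iff)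
  show ?thesis
    unfolding eval_mon_def split prod_dividef prod.distrib single
    by (simp add: mon_deg_def power_sum)
qed

text \<open>At the point with coordinates \<open>X / S\<close>, \<open>T / S\<close> and
  \<open>1 / S\<close>, which sum to 1, \<open>p\<close> has the value 1. Multiplication by
  \<open>S ^ d\<close> leaves \<open>S ^ (d - m)\<close> at the terms of degree
  \<open>m\<close>.\<close>

lemma slice_identity:
  assumes p: "p \<in> H n d" and j: "j < n" and l: "l < n" "j \<noteq> l"
  defines "s \<equiv> [:[:real n - 2, 1:], 1:]"
  shows "(\<Sum>m\<le>d. slice p j l m * s ^ (d - m)) = s ^ d"
proof -
  let ?K = "Poly_Mapping.keys p"
  have "(\<Sum>m\<le>d. slice p j l m * s ^ (d - m)) - s ^ d = 0"
  proof (rule bivariate_poly_eq_0I)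
    fix X T :: real assume XT: "X > 0" "T > 0"
    define S where "S = X + T + (real n - 2)"
    have n2: "n \<ge> 2" using j l by linarith
    then have S: "S > 0" using XT by (simp add: S_def)
    define x where "x = (\<lambda>k. (if k = j then X else if k = l then T else 1) / S)"
    \<comment> \<open>Coordinates are written as corrections to 1.\<close>
    have "(\<Sum>k<n. if k = j then X else if k = l then T else 1)
        = (\<Sum>k<n. (if k = j then X - 1 else 0) + (if k = l then T - 1 else 0) + 1)"
      using l by (intro sum.cong) auto
    also have "\<dots> = S" using j l n2 by (simp add: sum.distrib S_def)
    finally have "(\<Sum>k<n. x k) = 1" using S by (simp add: x_def sum_divide_distrib[symmetric])
    then have 1: "eval_poly p x = 1" using p by (simp add: H_def)
    have ev: "poly (poly (slice p j l m) [:X:]) T = (\<Sum>\<alpha> | \<alpha> \<in> ?K \<and> mon_deg \<alpha> = m.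
       Poly_Mapping.lookup p \<alpha> * (X ^ Poly_Mapping.lookup \<alpha> j * T ^ Poly_Mapping.lookup \<alpha> l))" for m
      by (simp add: slice_def poly_sum poly_monom mult_ac)
    have deg: "mon_deg \<alpha> \<le> d" if "\<alpha> \<in> ?K" for \<alpha>
      using mon_deg_le_total_deg[OF that] p by (simp add: H_def)
    have s: "poly (poly s [:X:]) T = S" by (simp add: s_def S_def algebra_simps)
    have "poly (poly (\<Sum>m\<le>d. slice p j l m * s ^ (d - m)) [:X:]) T
      = (\<Sum>m\<le>d. \<Sum>\<alpha> | \<alpha> \<in> ?K \<and> mon_deg \<alpha> = m. S ^ d * (Poly_Mapping.lookup p \<alpha> * eval_mon \<alpha> x))"
      unfolding poly_sum poly_mult poly_power s ev sum_distrib_right x_def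
        eval_mon_two_variables[OF l(2)]
      using S by (intro sum.cong refl) (auto simp: power_diff)
    also have "\<dots> = (\<Sum>\<alpha>\<in>?K. S ^ d * (Poly_Mapping.lookup p \<alpha> * eval_mon \<alpha> x))"
      by (rule sum.group) (use deg in auto)
    also have "\<dots> = S ^ d" using 1 by (simp add: eval_poly_def sum_distrib_left[symmetric])
    finally show "poly (poly ((\<Sum>m\<le>d. slice p j l m * s ^ (d - m)) - s ^ d) [:X:]) T = 0"
      by (simp add: s)
  qed
  then show ?thesis by simp
qed

section \<open>Counting the monomials divisible by \<open>x\<^sub>j\<close>\<close>

theorem mainTheorem18:
  fixes n d :: nat and p :: mpoly_real
  assumes "n \<ge> 3" and "p \<in> H n d"
  shows "\<forall>j<n. card {\<alpha>\<in>Poly_Mapping.keys p. Poly_Mapping.lookup \<alpha> j > 0} \<ge> d"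
proof (intro allI impI)
  fix j assume j: "j < n"
  let ?A = "{\<alpha>\<in>Poly_Mapping.keys p. Poly_Mapping.lookup \<alpha> j > 0}"
  show "card ?A \<ge> d"
  proof (cases "d = 0")
    case False
    define l where "l = (if j = 0 then 1 else 0 :: nat)"
    have l: "l < n" "j \<noteq> l" using assms(1) by (auto simp: l_def)
    let ?P = "slice p j l"
    have pos: "Poly_Mapping.lookup p \<alpha> \<ge> 0" for \<alpha> using assms(2) by (simp add: H_def)
    have td: "total_deg p = d" using assms(2) by (simp add: H_def)
    obtain \<beta> where \<beta>: "\<beta> \<in> Poly_Mapping.keys p" "mon_deg \<beta> = d"
      using total_deg_attained[of p] td False by auto
    have "0 < Poly_Mapping.lookup p \<beta>"
      using pos[of \<beta>] \<beta>(1) by (simp add: in_keys_iff)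
    \<comment> \<open>Nonnegativity prevents cancellation among monomials that coincide once
      variables are set to 1.\<close>
    also have "\<dots> \<le> coeff (coeff (?P d) (Poly_Mapping.lookup \<beta> j)) (Poly_Mapping.lookup \<beta> l)"
      unfolding coeff_slice
      using \<beta> pos member_le_sum[of \<beta> "{\<alpha> \<in> Poly_Mapping.keys p. mon_deg \<alpha> = d}"
        "\<lambda>\<alpha>. if Poly_Mapping.lookup \<alpha> j = Poly_Mapping.lookup \<beta> j \<and> Poly_Mapping.lookup \<alpha> l = Poly_Mapping.lookup \<beta> l
          then Poly_Mapping.lookup p \<alpha> else 0"] by simp
    finally have nz: "?P d \<noteq> 0" by force
    have deg: "coeff (?P m) i = 0" if "i > m" for m i
    proof (rule poly_eqI, rule ccontr)
      fix b assume "coeff (coeff (?P m) i) b \<noteq> coeff 0 b"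
      then show False using that lookup_le_mon_deg[of _ j] by (auto elim!: coeff_slice_neq_0D simp: not_less[symmetric])
    qed
    \<comment> \<open>The assumption \<open>n \<ge> 3\<close> makes \<open>c = n - 2\<close>
      positive.\<close>
    have "d \<le> (\<Sum>k<d. \<Sum>i=1..Suc k. card (support (coeff (?P (Suc k)) i)))"
      using assms(1) deg nz pos
      by (intro degree_le_sum_card_support[where c = "real n - 2"] slice_identity[OF assms(2) j l])
        (auto simp: coeff_slice intro!: sum_nonneg)
    also have "\<dots> = card (SIGMA k:{..<d}. SIGMA i:{1..Suc k}. support (coeff (?P (Suc k)) i))"
      by (simp add: card_SigmaI finite_support)
    \<comment> \<open>The shift by 1 matches the degree \<open>Suc k\<close>, and
      \<open>i \<ge> 1\<close> means divisibility by \<open>x\<^sub>j\<close>. Several monomials may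
      share an image; covering the set is enough.\<close>
    also have "\<dots> \<le> card ((\<lambda>\<alpha>. (mon_deg \<alpha> - 1, Poly_Mapping.lookup \<alpha> j, Poly_Mapping.lookup \<alpha> l)) ` ?A)"
    proof (rule card_mono)
      show "(SIGMA k:{..<d}. SIGMA i:{1..Suc k}. support (coeff (?P (Suc k)) i))
        \<subseteq> (\<lambda>\<alpha>. (mon_deg \<alpha> - 1, Poly_Mapping.lookup \<alpha> j, Poly_Mapping.lookup \<alpha> l)) ` ?A"
      proof clarify
        fix k i b assume i: "i \<in> {1..Suc k}" and b: "coeff (coeff (?P (Suc k)) i) b \<noteq> 0"
        obtain \<alpha> where "\<alpha> \<in> Poly_Mapping.keys p" "mon_deg \<alpha> = Suc k"
          "Poly_Mapping.lookup \<alpha> j = i" "Poly_Mapping.lookup \<alpha> l = b"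
          by (rule coeff_slice_neq_0D[OF b])
        then show "(k, i, b) \<in> (\<lambda>\<alpha>. (mon_deg \<alpha> - 1, Poly_Mapping.lookup \<alpha> j, Poly_Mapping.lookup \<alpha> l)) ` ?A"
          using i by (intro image_eqI[of _ _ \<alpha>]) auto
      qed
    qed simp
    also have "\<dots> \<le> card ?A" by (rule card_image_le) simp
    finally show ?thesis .
  qed simp
qed

end
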